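(* Let $0<\alpha<1$ and $\varepsilon>0$, and let $u^0,u^1,\dots,u^N\in\mathbb{V}_h$ be a solution of the fully discrete backward Euler scheme $$(\partial_f^\alpha u)^n=\varepsilon^2 D_h u^n-f(u^n),\quad 1\le n\le N,\qquad u_h^0=u_0(\mathbf{x}_h)\ \text{ at all grid points } \mathbf{x}_h,$$ where $f(v)=v^3-v$ is applied componentwise, on an arbitrary (possibly nonuniform) time mesh $0=t_0<t_1<\dots<t_N=T$. If $\|u^0\|_\infty\le 1$ and the maximum time-step size satisfies $$\tau\le \frac{1}{\sqrt[\alpha]{\Gamma(2-\alpha)}},$$ then $\|u^k\|_\infty\le 1$ for all $0\le k\le N$. That is, the scheme preserves the discrete counterpart of the maximum principle "$|u(\mathbf{x},t)|\le 1$ for $t>0$ if $|u(\mathbf{x},0)|\le1$" and, in this sense, is unconditionally stable in the maximum norm.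
   Context: The continuous problem is the time-fractional Allen-Cahn equation $\partial_t^\alpha u=\varepsilon^2\Delta u-f(u)$ on $\Omega=(a,b)\times(c,d)$, $0<t\le T$, with periodic boundary conditions, $u(\mathbf{x},0)=u_0(\mathbf{x})$, $f(u)=u^3-u$, where $\partial_t^\alpha$ is the Caputo derivative of order $\alpha\in(0,1)$, $(\partial_t^\alpha v)(t)=\int_0^t\omega_{1-\alpha}(t-s)v'(s)\,ds$, and $\omega_\mu(t):=t^{\mu-1}/\Gamma(\mu)$. Time mesh: $0=t_0<t_1<\dots<t_N=T$, $\tau_k:=t_k-t_{k-1}$, $\tau:=\max_{1\le k\le N}\tau_k$, and $\nabla_\tau v^k:=v^k-v^{k-1}$. Sum-of-exponentials (SOE) approximation: for the tolerance $\epsilon>0$ and the cut-off time $\Delta t>0$, with $\Delta t\le\min_k\tau_k$, there are fixed a positive integer $N_q$, positive nodes $\theta^\ell$ and positive weights $\varpi^\ell$ ($1\le\ell\le N_q$) with $\left|\omega_{1-\alpha}(t)-\sum_{\ell=1}^{N_q}\varpi^\ell e^{-\theta^\ell t}\right|\le\epsilon$ for all $t\in[\Delta t,T]$. Fast L1 formula: $(\partial_f^\alpha v)^n:=\sum_{k=1}^n A_{n-k}^{(n)}\nabla_\tau v^k$, $n\ge1$, where $$A_0^{(n)}:=a_0^{(n)},\qquad A_{n-k}^{(n)}:=\frac1{\tau_k}\int_{t_{k-1}}^{t_k}\sum_{\ell=1}^{N_q}\varpi^\ell e^{-\theta^\ell(t_n-s)}\,ds\quad(1\le k\le n-1),$$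 $$a_{n-k}^{(n)}:=\frac1{\tau_k}\int_{t_{k-1}}^{t_k}\omega_{1-\alpha}(t_n-s)\,ds\quad(1\le k\le n),$$ so that $A_0^{(n)}=\tau_n^{-\alpha}/\Gamma(2-\alpha)$. Standing assumption: $\epsilon\le\min\{\tfrac13\omega_{1-\alpha}(T),\ \alpha\,\omega_{2-\alpha}(1)\}$, together with the resulting kernel properties (known from the literature and taken as given): (i) $A_{k-1}^{(n)}>A_k^{(n)}>0$ for $1\le k\le n-1$; (ii) $A_{n-k}^{(n)}\ge\frac23 a_{n-k}^{(n)}$ for $1\le k\le n-1$. Spatial discretization: $M_1,M_2$ are positive integers ($\ge3$), $h_1=(b-a)/M_1$, $h_2=(d-c)/M_2$, $x_i=a+ih_1$, $y_j=c+jh_2$, $\mathbf{x}_h=(x_i,y_j)$. $\mathbb{V}_h$ is the space of real grid vectors $v=(v_{i,j})$, $0\le i\le M_1-1$, $0\le j\le M_2-1$ (extended periodically), ordered with $i$ running fastest. $\|v\|_\infty$ is the maximum of $|v_{i,j}|$ over the grid. $D_h=I_1\otimes D_1+D_2\otimes I_2$ is the periodic five-point discrete Laplacian, where $I_1,I_2$ are identity matrices of orders $M_2$ and $M_1$, and $D_1$ (order $M_1$), $D_2$ (order $M_2$) are $h_1^{-2}$, respectively $h_2^{-2}$, times the circulant matrix with $-2$ on the diagonal, $1$ on the two adjacent off-diagonals, and $1$ in the top-right and bottom-left corners. *)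

theory Defs
  imports "HOL-Analysis.Analysis" "Jordan_Normal_Form.Matrix"
begin

unbundle no vec_syntax

section \<open>Kernel, time mesh and fast L1 formula\<close>

definition omega :: "real \<Rightarrow> real \<Rightarrow> real" where
  "omega \<mu> t = t powr (\<mu> - 1) / Gamma \<mu>"

definition tstep :: "(nat \<Rightarrow> real) \<Rightarrow> nat \<Rightarrow> real" where
  "tstep t k = t k - t (k - 1)"

text \<open>
  The coefficients are indexed as in the literature: \<open>L1_coeff \<alpha> t n j\<close> is
  \<open>a\<^sub>j\<close> at time level \<open>n\<close>, which belongs to the mesh interval with number
  \<open>k = n - j\<close>. Only \<open>j < n\<close> is meaningful; otherwise natural subtraction truncates.
  At \<open>j = 0\<close> the integrand is singular at the right end point, where \<open>powr\<close> gives the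
  value 0; this does not affect the integral.
\<close>

definition L1_coeff :: "real \<Rightarrow> (nat \<Rightarrow> real) \<Rightarrow> nat \<Rightarrow> nat \<Rightarrow> real" where
  "L1_coeff \<alpha> t n j =
     (let k = n - j in
      1 / tstep t k * integral {t (k - 1)..t k} (\<lambda>s. omega (1 - \<alpha>) (t n - s)))"

definition soe :: "nat \<Rightarrow> (nat \<Rightarrow> real) \<Rightarrow> (nat \<Rightarrow> real) \<Rightarrow> real \<Rightarrow> real" where
  "soe Nq \<theta> w s = (\<Sum>l=1..Nq. w l * exp (- \<theta> l * s))"

definition fast_L1_coeff ::
  "real \<Rightarrow> nat \<Rightarrow> (nat \<Rightarrow> real) \<Rightarrow> (nat \<Rightarrow> real) \<Rightarrow> (nat \<Rightarrow> real) \<Rightarrow> nat \<Rightarrow> nat \<Rightarrow> real" where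
  "fast_L1_coeff \<alpha> Nq \<theta> w t n j =
     (if j = 0 then L1_coeff \<alpha> t n 0
      else (let k = n - j in
        1 / tstep t k * integral {t (k - 1)..t k} (\<lambda>s. soe Nq \<theta> w (t n - s))))"

definition fast_L1 ::
  "real \<Rightarrow> nat \<Rightarrow> (nat \<Rightarrow> real) \<Rightarrow> (nat \<Rightarrow> real) \<Rightarrow> (nat \<Rightarrow> real) \<Rightarrow> (nat \<Rightarrow> real) \<Rightarrow> nat \<Rightarrow> real" where
  "fast_L1 \<alpha> Nq \<theta> w t v n =
     (\<Sum>k=1..n. fast_L1_coeff \<alpha> Nq \<theta> w t n (n - k) * (v k - v (k - 1)))"

section \<open>Grid vectors and the discrete Laplacian\<close>

text \<open>
  A grid function on the \<open>M1 \<times> M2\<close> periodic grid is a vector of dimension \<open>M1 * M2\<close>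
  whose entry number \<open>i + j * M1\<close> is the value at \<open>(x\<^sub>i, y\<^sub>j)\<close>.
\<close>

definition grid_space :: "nat \<Rightarrow> nat \<Rightarrow> real vec set" where
  "grid_space M1 M2 = carrier_vec (M1 * M2)"

definition max_norm :: "real vec \<Rightarrow> real" where
  "max_norm v = Max ((\<lambda>p. \<bar>v $ p\<bar>) ` {..<dim_vec v})"

definition kronecker :: "real mat \<Rightarrow> real mat \<Rightarrow> real mat" (infixl \<open>\<otimes>\<^sub>K\<close> 70) where
  "A \<otimes>\<^sub>K B = mat (dim_row A * dim_row B) (dim_col A * dim_col B)
     (\<lambda>(r, s). A $$ (r div dim_row B, s div dim_col B) * B $$ (r mod dim_row B, s mod dim_col B))"

definition diff_matrix :: "nat \<Rightarrow> real \<Rightarrow> real mat" where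
  "diff_matrix M h = (1 / h\<^sup>2) \<cdot>\<^sub>m mat M M (\<lambda>(r, s).
     if r = s then - 2
     else if r = s + 1 \<or> s = r + 1 \<or> (r = 0 \<and> s = M - 1) \<or> (r = M - 1 \<and> s = 0) then 1
     else 0)"

definition discrete_laplacian :: "nat \<Rightarrow> nat \<Rightarrow> real \<Rightarrow> real \<Rightarrow> real mat" where
  "discrete_laplacian M1 M2 h1 h2 =
     (1\<^sub>m M2 \<otimes>\<^sub>K diff_matrix M1 h1) + (diff_matrix M2 h2 \<otimes>\<^sub>K 1\<^sub>m M1)"

section \<open>Backward Euler scheme\<close>

definition fast_L1_vec ::
  "real \<Rightarrow> nat \<Rightarrow> (nat \<Rightarrow> real) \<Rightarrow> (nat \<Rightarrow> real) \<Rightarrow> (nat \<Rightarrow> real) \<Rightarrow> (nat \<Rightarrow> real vec) \<Rightarrow> nat \<Rightarrow> real vec" where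
  "fast_L1_vec \<alpha> Nq \<theta> w t u n =
     vec (dim_vec (u n)) (\<lambda>p. fast_L1 \<alpha> Nq \<theta> w t (\<lambda>k. u k $ p) n)"

definition reaction :: "real \<Rightarrow> real" where
  "reaction v = v ^ 3 - v"

end

theory Submission
  imports Defs
begin

text \<open>
  The argument is a discrete maximum principle, by strong induction on the time level. Suppose
  that all earlier levels are bounded by 1 and let \<open>p\<close> be a grid point where \<open>\<bar>u\<^sup>n\<bar>\<close> attains its
  maximum \<open>m\<close>; after a change of sign \<open>u\<^sup>n\<close> attains its maximum \<open>m\<close> at \<open>p\<close>. Two facts bound the
  two sides of the scheme at \<open>p\<close>.

  \<^item> The discrete Laplacian has nonnegative off-diagonal entries and vanishing row sums, so it is
    nonpositive at a maximum (\<open>generator_nonpos_at_maximum\<close>). The right-hand side is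
    therefore at most \<open>m - m\<^sup>3\<close>.

  \<^item> The kernel of the memory sum is nonnegative and decreasing. Abel summation turns the
    sum into the leading coefficient \<open>A\<^sub>0\<close> times \<open>u\<^sup>n\<close> minus a combination of the earlier values
    with nonnegative coefficients of total mass \<open>A\<^sub>0\<close>. As these values are at most 1, the
    left-hand side is at least \<open>A\<^sub>0 (m - 1)\<close> (\<open>memory_sum_lower_bound\<close>).

  Hence \<open>A\<^sub>0 (m - 1) \<le> m - m\<^sup>3\<close>. For \<open>m > 1\<close> the left-hand side would be nonnegative and the
  right-hand side negative, so \<open>m \<le> 1\<close>.
\<close>

section \<open>Generator matrices and the maximum principle\<close>

text \<open>
  These are the generators (Q-matrices) of continuous-time Markov chains. The class is stable
  under the sums and the Kronecker products with an identity from which the two-dimensional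
  Laplacian is assembled.
\<close>

definition generator_matrix :: "nat \<Rightarrow> real mat \<Rightarrow> bool" where
  "generator_matrix n A \<longleftrightarrow> A \<in> carrier_mat n n
     \<and> (\<forall>r<n. \<forall>s<n. r \<noteq> s \<longrightarrow> 0 \<le> A $$ (r, s))
     \<and> (\<forall>r<n. (\<Sum>s<n. A $$ (r, s)) = 0)"

text \<open>
  Because the row sums vanish, a constant may be subtracted from \<open>g\<close>; subtracting \<open>g p\<close> leaves
  only products of nonnegative off-diagonal entries with nonpositive differences.
\<close>

lemma generator_nonpos_at_maximum:
  assumes A: "generator_matrix n A" and p: "p < n" and max: "\<And>q. q < n \<Longrightarrow> g q \<le> g p"
  shows "(\<Sum>q<n. A $$ (p, q) * g q) \<le> 0"
proof -
  have "(\<Sum>q<n. A $$ (p, q)) = 0"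
    using A p by (simp add: generator_matrix_def)
  then have "(\<Sum>q<n. A $$ (p, q) * g q) = (\<Sum>q<n. A $$ (p, q) * (g q - g p))"
    by (simp add: right_diff_distrib sum_subtractf flip: sum_distrib_right)
  also have "\<dots> \<le> 0"
  proof (rule sum_nonpos)
    fix q assume q: "q \<in> {..<n}"
    show "A $$ (p, q) * (g q - g p) \<le> 0"
    proof (cases "q = p")
      case False
      then have "0 \<le> A $$ (p, q)"
        using A p q by (auto simp: generator_matrix_def)
      then show ?thesis
        using max q by (simp add: mult_nonneg_nonpos)
    qed simp
  qed
  finally show ?thesis .
qed

lemma generator_matrix_add:
  assumes "generator_matrix n A" "generator_matrix n B"
  shows "generator_matrix n (A + B)"
  using assms by (auto simp: generator_matrix_def sum.distrib)

lemma sum_product_index: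
  fixes f g :: "nat \<Rightarrow> real"
  shows "(\<Sum>s<m * k. f (s div k) * g (s mod k)) = sum f {..<m} * sum g {..<k}"
proof -
  have "(\<Sum>s<m * k. f (s div k) * g (s mod k))
      = (\<Sum>i<m. \<Sum>s\<in>{i * k..<i * k + k}. f (s div k) * g (s mod k))"
    by (rule sum.nat_group [symmetric])
  also have "\<dots> = (\<Sum>i<m. \<Sum>j<k. f i * g j)"
  proof (rule sum.cong [OF refl])
    fix i
    show "(\<Sum>s\<in>{i * k..<i * k + k}. f (s div k) * g (s mod k)) = (\<Sum>j<k. f i * g j)"
      using sum.shift_bounds_nat_ivl [of "\<lambda>s. f (s div k) * g (s mod k)" 0 "i * k" k]
      by (simp add: lessThan_atLeast0 add.commute)
  qed
  finally show ?thesis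
    by (simp add: sum_product)
qed

lemma kronecker_index:
  assumes "A \<in> carrier_mat m m" "B \<in> carrier_mat k k" "r < m * k" "s < m * k"
  shows "(A \<otimes>\<^sub>K B) $$ (r, s) = A $$ (r div k, s div k) * B $$ (r mod k, s mod k)"
  using assms by (auto simp: kronecker_def)

lemma kronecker_row_sum:
  assumes "A \<in> carrier_mat m m" "B \<in> carrier_mat k k" "r < m * k"
  shows "(\<Sum>s<m * k. (A \<otimes>\<^sub>K B) $$ (r, s))
       = (\<Sum>i<m. A $$ (r div k, i)) * (\<Sum>j<k. B $$ (r mod k, j))"
  using assms sum_product_index [of "\<lambda>i. A $$ (r div k, i)" k "\<lambda>j. B $$ (r mod k, j)" m]
  by (simp add: kronecker_index)

lemma split_index_less:
  fixes r m k :: nat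
  assumes "r < m * k"
  shows "r div k < m" "r mod k < k"
  using assms by (cases "k = 0"; simp add: less_mult_imp_div_less)+

lemma split_index_neq:
  fixes r s k :: nat
  assumes "r \<noteq> s"
  shows "r div k \<noteq> s div k \<or> r mod k \<noteq> s mod k"
  using assms by (metis div_mult_mod_eq)

text \<open>
  Two different indices differ in the quotient or in the remainder. An off-diagonal entry of the
  product is therefore zero, because of the identity factor, or an off-diagonal entry of the
  other factor.
\<close>

lemma generator_matrix_one_kronecker:
  assumes B: "generator_matrix k B"
  shows "generator_matrix (m * k) (1\<^sub>m m \<otimes>\<^sub>K B)"
  unfolding generator_matrix_def
proof (intro conjI allI impI)
  have Bc: "B \<in> carrier_mat k k" using B by (simp add: generator_matrix_def)
  then show "1\<^sub>m m \<otimes>\<^sub>K B \<in> carrier_mat (m * k) (m * k)" by (auto simp: kronecker_def)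
  fix r assume r: "r < m * k"
  note rk = split_index_less [OF r]
  show "(\<Sum>s<m * k. (1\<^sub>m m \<otimes>\<^sub>K B) $$ (r, s)) = 0"
    using B Bc r rk by (simp add: kronecker_row_sum generator_matrix_def)
  fix s assume s: "s < m * k" and "r \<noteq> s"
  then show "0 \<le> (1\<^sub>m m \<otimes>\<^sub>K B) $$ (r, s)"
    using B rk split_index_less [OF s] split_index_neq [of r s k]
    by (auto simp: kronecker_index [OF one_carrier_mat Bc r s] generator_matrix_def)
qed

lemma generator_matrix_kronecker_one:
  assumes A: "generator_matrix m A"
  shows "generator_matrix (m * k) (A \<otimes>\<^sub>K 1\<^sub>m k)"
  unfolding generator_matrix_def
proof (intro conjI allI impI)
  have Ac: "A \<in> carrier_mat m m" using A by (simp add: generator_matrix_def)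
  then show "A \<otimes>\<^sub>K 1\<^sub>m k \<in> carrier_mat (m * k) (m * k)" by (auto simp: kronecker_def)
  fix r assume r: "r < m * k"
  note rk = split_index_less [OF r]
  show "(\<Sum>s<m * k. (A \<otimes>\<^sub>K 1\<^sub>m k) $$ (r, s)) = 0"
    using A Ac r rk by (simp add: kronecker_row_sum generator_matrix_def)
  fix s assume s: "s < m * k" and "r \<noteq> s"
  then show "0 \<le> (A \<otimes>\<^sub>K 1\<^sub>m k) $$ (r, s)"
    using A rk split_index_less [OF s] split_index_neq [of r s k]
    by (auto simp: kronecker_index [OF Ac one_carrier_mat r s] generator_matrix_def)
qed

text \<open>
  The bound \<open>3 \<le> M\<close> makes the two cyclic neighbours of a point distinct; for \<open>M = 2\<close> they would
  share one entry equal to 1 and the row sum would be negative.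
\<close>

lemma generator_matrix_diff_matrix:
  assumes M: "3 \<le> M"
  shows "generator_matrix M (diff_matrix M h)"
  unfolding generator_matrix_def
proof (intro conjI allI impI)
  show "diff_matrix M h \<in> carrier_mat M M" by (simp add: diff_matrix_def)
  fix r assume r: "r < M"
  define nxt where "nxt = (if r = M - 1 then 0 else r + 1)"
  define prv where "prv = (if r = 0 then M - 1 else r - 1)"
  have distinct: "nxt < M" "prv < M" "nxt \<noteq> r" "prv \<noteq> r" "nxt \<noteq> prv"
    using M r by (auto simp: nxt_def prv_def)
  have neighbours: "r = s + 1 \<or> s = r + 1 \<or> (r = 0 \<and> s = M - 1) \<or> (r = M - 1 \<and> s = 0)
      \<longleftrightarrow> s = nxt \<or> s = prv" if "s < M" for s
    using M r that unfolding nxt_def prv_def by (cases "r = 0"; cases "r = M - 1") arith+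
  have "(\<Sum>s<M. diff_matrix M h $$ (r, s)) = (\<Sum>s<M. 1 / h\<^sup>2 *
      ((if s = r then - 2 else 0) + (if s = nxt then 1 else 0) + (if s = prv then 1 else 0)))"
    using r distinct neighbours by (intro sum.cong) (auto simp: diff_matrix_def)
  also have "\<dots> = 0"
    using r distinct unfolding sum_distrib_left [symmetric] by (simp add: sum.distrib)
  finally show "(\<Sum>s<M. diff_matrix M h $$ (r, s)) = 0" .
  fix s assume "s < M" "r \<noteq> s"
  then show "0 \<le> diff_matrix M h $$ (r, s)"
    using r by (simp add: diff_matrix_def)
qed

lemma generator_matrix_discrete_laplacian:
  assumes "3 \<le> M1" "3 \<le> M2"
  shows "generator_matrix (M1 * M2) (discrete_laplacian M1 M2 h1 h2)"
proof -
  have "generator_matrix (M2 * M1) (discrete_laplacian M1 M2 h1 h2)"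
    unfolding discrete_laplacian_def
    using assms by (intro generator_matrix_add generator_matrix_one_kronecker
        generator_matrix_kronecker_one generator_matrix_diff_matrix)
  then show ?thesis by (simp add: mult.commute)
qed

section \<open>The memory sum\<close>

text \<open>
  Abel summation, carried out as an induction on the number of steps: splitting off the newest
  increment, from \<open>y\<close> to \<open>z\<close> say, leaves the memory sum for the shifted kernel \<open>\<lambda>j. A (Suc j)\<close>.
  The induction hypothesis bounds it below by \<open>A 1 * (y - B)\<close>. Together with the split-off term
  \<open>A 0 * (z - y)\<close> this is \<open>A 0 * (z - B) + (A 1 - A 0) * (y - B)\<close>, whose second summand is a
  product of two nonpositive numbers.
\<close>

lemma memory_sum_lower_bound:
  fixes A v :: "nat \<Rightarrow> real"
  assumes "\<And>j. j < n \<Longrightarrow> A (Suc j) \<le> A j" "0 \<le> A n" "\<And>k. k \<le> n \<Longrightarrow> v k \<le> B"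
  shows "A 0 * (v (Suc n) - B) \<le> (\<Sum>k=1..Suc n. A (Suc n - k) * (v k - v (k - 1)))"
  using assms
proof (induction n arbitrary: A)
  case 0
  then have "0 \<le> A 0 * (B - v 0)" by simp
  then show ?case by (simp add: algebra_simps)
next
  case (Suc n)
  have "A (Suc 0) * (v (Suc n) - B)
      \<le> (\<Sum>k=1..Suc n. A (Suc (Suc n - k)) * (v k - v (k - 1)))"
    using Suc.IH [of "\<lambda>j. A (Suc j)"] Suc.prems by simp
  also have "\<dots> = (\<Sum>k=1..Suc n. A (Suc (Suc n) - k) * (v k - v (k - 1)))"
    by (intro sum.cong) (auto simp: Suc_diff_le)
  finally have "A (Suc 0) * (v (Suc n) - B) + A 0 * (v (Suc (Suc n)) - v (Suc n))
      \<le> (\<Sum>k=1..Suc (Suc n). A (Suc (Suc n) - k) * (v k - v (k - 1)))"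
    by simp
  moreover have "0 \<le> (A 0 - A (Suc 0)) * (B - v (Suc n))"
    using Suc.prems by simp
  ultimately show ?case by (simp add: algebra_simps)
qed

lemma fast_L1_scale:
  "fast_L1 \<alpha> Nq \<theta> w t (\<lambda>k. s * v k) n = s * fast_L1 \<alpha> Nq \<theta> w t v n"
  by (simp add: fast_L1_def sum_distrib_left algebra_simps)

lemma fast_L1_leading_coeff_nonneg:
  assumes "\<alpha> < 1" "t (n - 1) \<le> t n"
  shows "0 \<le> fast_L1_coeff \<alpha> Nq \<theta> w t n 0"
proof -
  have "0 \<le> integral {t (n - 1)..t n} (\<lambda>s. omega (1 - \<alpha>) (t n - s))"
  proof (cases "(\<lambda>s. omega (1 - \<alpha>) (t n - s)) integrable_on {t (n - 1)..t n}")
    case True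
    then show ?thesis
      using assms by (intro integral_nonneg) (simp_all add: omega_def Gamma_real_nonneg)
  qed (simp add: not_integrable_integral)
  then show ?thesis
    using assms by (simp add: fast_L1_coeff_def L1_coeff_def tstep_def)
qed

section \<open>One time step\<close>

lemma max_norm_le_iff:
  assumes "0 < dim_vec v"
  shows "max_norm v \<le> B \<longleftrightarrow> (\<forall>p<dim_vec v. \<bar>v $ p\<bar> \<le> B)"
  unfolding max_norm_def using assms by (subst Max_le_iff) auto

text \<open>
  Beyond the stable equilibrium 1 the cubic term pulls back: for \<open>m > 1\<close> the two sides of the
  inequality would have opposite signs.
\<close>

lemma cubic_damping_bound:
  fixes A m :: real
  assumes "0 \<le> A" "A * (m - 1) \<le> m - m ^ 3"
  shows "m \<le> 1"
proof (rule ccontr)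
  assume "\<not> m \<le> 1"
  then have m: "1 < m" by simp
  have "0 < m * (m - 1) * (m + 1)" using m by simp
  also have "\<dots> = m ^ 3 - m" by (simp add: algebra_simps power3_eq_cube)
  finally have "m - m ^ 3 < 0" by simp
  moreover have "0 \<le> A * (m - 1)" using m assms(1) by simp
  ultimately show False using assms(2) by simp
qed

section \<open>The maximum bound of the scheme\<close>

theorem theorem2p1:
  fixes \<alpha> \<epsilon> tol \<Delta>t T a b c d h1 h2 :: real
    and N Nq M1 M2 :: nat
    and t \<theta> w :: "nat \<Rightarrow> real"
    and u0 :: "real \<times> real \<Rightarrow> real"
    and u :: "nat \<Rightarrow> real vec"
  assumes alpha: "0 < \<alpha>" "\<alpha> < 1"
    and epsilon: "0 < \<epsilon>"
    and mesh: "1 \<le> N" "t 0 = 0" "t N = T" "\<forall>k\<in>{1..N}. t (k - 1) < t k"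
    and cutoff: "0 < \<Delta>t" "\<Delta>t \<le> Min (tstep t ` {1..N})"
    and soe_params: "0 < tol" "1 \<le> Nq" "\<forall>l\<in>{1..Nq}. 0 < \<theta> l" "\<forall>l\<in>{1..Nq}. 0 < w l"
    and soe_approx: "\<forall>s\<in>{\<Delta>t..T}. \<bar>omega (1 - \<alpha>) s - soe Nq \<theta> w s\<bar> \<le> tol"
    and tol_bound: "tol \<le> min (1 / 3 * omega (1 - \<alpha>) T) (\<alpha> * omega (2 - \<alpha>) 1)"
    and kernel_mono: "\<forall>n\<in>{1..N}. \<forall>k\<in>{1..n - 1}.
          fast_L1_coeff \<alpha> Nq \<theta> w t n (k - 1) > fast_L1_coeff \<alpha> Nq \<theta> w t n k
          \<and> fast_L1_coeff \<alpha> Nq \<theta> w t n k > 0"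
    and kernel_bound: "\<forall>n\<in>{1..N}. \<forall>k\<in>{1..n - 1}.
          fast_L1_coeff \<alpha> Nq \<theta> w t n (n - k) \<ge> 2 / 3 * L1_coeff \<alpha> t n (n - k)"
    and grid: "a < b" "c < d" "3 \<le> M1" "3 \<le> M2"
          "h1 = (b - a) / real M1" "h2 = (d - c) / real M2"
    and space: "\<forall>n\<le>N. u n \<in> grid_space M1 M2"
    and scheme: "\<forall>n\<in>{1..N}. fast_L1_vec \<alpha> Nq \<theta> w t u n
          = \<epsilon>\<^sup>2 \<cdot>\<^sub>v (discrete_laplacian M1 M2 h1 h2 *\<^sub>v u n) - map_vec reaction (u n)"
    and initial: "\<forall>i<M1. \<forall>j<M2. u 0 $ (i + j * M1) = u0 (a + real i * h1, c + real j * h2)"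
    and initial_bound: "max_norm (u 0) \<le> 1"
    and step_bound: "Max (tstep t ` {1..N}) \<le> 1 / Gamma (2 - \<alpha>) powr (1 / \<alpha>)"
  shows "\<forall>k\<le>N. max_norm (u k) \<le> 1"
proof (intro allI impI)
  let ?n = "M1 * M2"
  let ?L = "discrete_laplacian M1 M2 h1 h2"
  let ?A = "fast_L1_coeff \<alpha> Nq \<theta> w t"
  have pos: "0 < ?n" using grid by simp
  have dim: "dim_vec (u k) = ?n" if "k \<le> N" for k
    using space that by (simp add: grid_space_def)
  have L: "generator_matrix ?n ?L"
    using grid by (intro generator_matrix_discrete_laplacian)
  then have Lc: "?L \<in> carrier_mat ?n ?n" by (simp add: generator_matrix_def)
  fix k assume "k \<le> N"
  then show "max_norm (u k) \<le> 1"
  proof (induction k rule: less_induct)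
    case (less k)
    show ?case
    proof (cases k)
      case 0
      then show ?thesis using initial_bound by simp
    next
      case (Suc n)
      have k: "k \<in> {1..N}" using Suc less.prems by simp
      have A0: "0 \<le> ?A k 0"
        using alpha bspec [OF mesh(4) k] by (intro fast_L1_leading_coeff_nonneg) simp_all
      have A_mono: "?A k (Suc j) \<le> ?A k j" if "j < n" for j
        using bspec [OF bspec [OF kernel_mono k], of "Suc j"] that Suc by simp
      have A_last: "0 \<le> ?A k n"
      proof (cases n)
        case (Suc j)
        then show ?thesis
          using bspec [OF bspec [OF kernel_mono k], of n] \<open>k = Suc n\<close> by simp
      qed (use A0 in simp)
      obtain p where p: "p < ?n" and p_max: "\<And>q. q < ?n \<Longrightarrow> \<bar>u k $ q\<bar> \<le> \<bar>u k $ p\<bar>"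
      proof -
        let ?S = "(\<lambda>q. \<bar>u k $ q\<bar>) ` {..<?n}"
        have "Max ?S \<in> ?S" using pos by (intro Max_in) (auto simp: lessThan_empty_iff)
        then obtain p where "p < ?n" "Max ?S = \<bar>u k $ p\<bar>" by auto
        moreover have "\<bar>u k $ q\<bar> \<le> Max ?S" if "q < ?n" for q
          using that by (intro Max_ge) auto
        ultimately show thesis using that by metis
      qed
      \<comment> \<open>With the sign of the extremal value, minima and maxima are treated at once.\<close>
      define \<sigma> :: real where "\<sigma> = (if 0 \<le> u k $ p then 1 else - 1)"
      have \<sigma>p: "\<sigma> * u k $ p = \<bar>u k $ p\<bar>" by (simp add: \<sigma>_def)
      have \<sigma>_le: "\<sigma> * y \<le> \<bar>y\<bar>" for y by (simp add: \<sigma>_def abs_ge_self abs_ge_minus_self)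
      have \<sigma>_react: "\<sigma> * reaction (u k $ p) = \<bar>u k $ p\<bar> ^ 3 - \<bar>u k $ p\<bar>"
        by (simp add: \<sigma>_def reaction_def abs_if power3_eq_cube)
      have past: "\<sigma> * u j $ p \<le> 1" if "j \<le> n" for j
      proof -
        have "max_norm (u j) \<le> 1"
          using less that Suc by simp
        then have "\<bar>u j $ p\<bar> \<le> 1"
          using dim [of j] pos p that Suc less.prems by (simp add: max_norm_le_iff)
        then show ?thesis using \<sigma>_le [of "u j $ p"] by simp
      qed
      have laplace: "\<sigma> * (?L *\<^sub>v u k) $ p \<le> 0"
      proof -
        have "(?L *\<^sub>v u k) $ p = (\<Sum>q<?n. ?L $$ (p, q) * u k $ q)"
          using Lc p dim [OF less.prems] by (auto simp: scalar_prod_def lessThan_atLeast0)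
        then have "\<sigma> * (?L *\<^sub>v u k) $ p = (\<Sum>q<?n. ?L $$ (p, q) * (\<sigma> * u k $ q))"
          by (simp add: sum_distrib_left mult.left_commute)
        also have "\<dots> \<le> 0"
          using \<sigma>p \<sigma>_le p_max by (intro generator_nonpos_at_maximum [OF L p]) (metis order_trans)
        finally show ?thesis .
      qed
      have "fast_L1 \<alpha> Nq \<theta> w t (\<lambda>j. u j $ p) k
          = \<epsilon>\<^sup>2 * (?L *\<^sub>v u k) $ p - reaction (u k $ p)"
        using arg_cong [OF bspec [OF scheme k], of "\<lambda>v. v $ p"] Lc p dim [OF less.prems]
        by (simp add: fast_L1_vec_def)
      then have "fast_L1 \<alpha> Nq \<theta> w t (\<lambda>j. \<sigma> * u j $ p) k
          = \<epsilon>\<^sup>2 * (\<sigma> * (?L *\<^sub>v u k) $ p) - \<sigma> * reaction (u k $ p)"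
        by (simp only: fast_L1_scale right_diff_distrib mult.left_commute)
      also have "\<dots> \<le> \<bar>u k $ p\<bar> - \<bar>u k $ p\<bar> ^ 3"
        using mult_nonneg_nonpos [OF zero_le_power2 laplace, of \<epsilon>] \<sigma>_react by simp
      finally have "fast_L1 \<alpha> Nq \<theta> w t (\<lambda>j. \<sigma> * u j $ p) k \<le> \<bar>u k $ p\<bar> - \<bar>u k $ p\<bar> ^ 3" .
      moreover have "?A k 0 * (\<bar>u k $ p\<bar> - 1) \<le> fast_L1 \<alpha> Nq \<theta> w t (\<lambda>j. \<sigma> * u j $ p) k"
        using memory_sum_lower_bound [of n "?A k" "\<lambda>j. \<sigma> * u j $ p" 1] A_mono A_last past \<sigma>p
        by (simp add: fast_L1_def Suc)
      ultimately have "\<bar>u k $ p\<bar> \<le> 1"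
        using cubic_damping_bound [OF A0] by simp
      then show ?thesis
        using p_max dim [OF less.prems] pos by (force simp: max_norm_le_iff)
    qed
  qed
qed

end
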